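(* Let $\mu_0$ be a Gaussian measure on $X=\mathbb{R}^{(2N+1)M}$ such that $\mu_0(X)=1$, and let the posterior measures satisfy $\mu^{U}\ll\mu_0$, with density with respect to $\mu_0$ $$\frac{d\mu^{U}}{d\mu_0}(A)=\frac{1}{L(U)}\exp\left(-G(A;U)\right),\qquad L(U)=\int_X\exp\left(-G(A;U)\right)d\mu_0(A).$$ Then for every $r>0$ there exists a constant $M_r>0$, depending on $r$, such that for all data $U_1,U_2\in L^2(\Gamma)$ with $\max\{\|U_1\|_{L^2(\Gamma)},\|U_2\|_{L^2(\Gamma)}\}\le r$, $$d_{\rm Hell}(\mu^{U_1},\mu^{U_2})\le M_r\,\|U_1-U_2\|_{L^2(\Gamma)}.$$
   Context: Let $\mathbb{S}=\{\hat{x}\in\mathbb{R}^2:|\hat{x}|=1\}$, let $\Gamma\subset\mathbb{S}$ be a (measurable) set of observation directions, and let $k\in K=[k_a,k_b]$, $0<k_a<k_b$, be the wavenumber. $L^2(\Gamma)$ is the space of complex-valued square integrable functions on $\Gamma$ with respect to arc length $ds(\hat{x})$. Let $\hat{B}\subset\mathbb{R}^2$ be a disc of radius $R>0$, and let $(\rho,\theta)$ be polar coordinates about its center. Fix integers $M\ge 1$, $N\ge 0$. Let $J_n$ be the Bessel function of the first kind of order $n$ and $q_{mn}$ the $m$-th positive zero of $J_n$. The Dirichlet eigenfunctions of the Laplacian on $\hat{B}$ are $$Q^1_{mn}(x)=\frac{1}{\sqrt{\pi}\,R\,J_{n+1}(q_{mn})}J_n\!\left(\frac{q_{mn}\rho}{R}\right)\cos(n\theta),\quad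 m\ge 1,\ n\ge 0,$$ $$Q^2_{mn}(x)=\frac{1}{\sqrt{\pi}\,R\,J_{n+1}(q_{mn})}J_n\!\left(\frac{q_{mn}\rho}{R}\right)\sin(n\theta),\quad m\ge 1,\ n\ge 1.$$ A vector $A\in X$ has components $A^1_{mn}$ ($1\le m\le M$, $0\le n\le N$) and $A^2_{mn}$ ($1\le m\le M$, $1\le n\le N$). Put $$f_{BE}(x)=\sum_{m=1}^M\left(\sum_{n=0}^N A^1_{mn}Q^1_{mn}(x)+\sum_{n=1}^N A^2_{mn}Q^2_{mn}(x)\right),\quad x\in\hat{B},$$ and define the forward operator $$\mathcal{F}(A)(\hat{x})=\int_{\hat{B}}\exp(-ik\,\hat{x}\cdot y)\,f_{BE}(y)\,dy,\quad \hat{x}\in\Gamma.$$ Fix a noise level $\sigma>0$. For measured data $U\in L^2(\Gamma)$ (statistical model $U=\mathcal{F}(A)+\eta$ with Gaussian noise $\eta\sim\mathcal{N}(0,\sigma^2\mathbb{I})$) let $$G(A;U)=\frac{1}{2\sigma^2}\|U-\mathcal{F}(A)\|^2_{L^2(\Gamma)}.$$ The measure $\mu_0$ is the prior and $\mu^U$ is the posterior measure of $A$ given $U$. The Hellinger distance between two probability measures $\mu_1$ and $\mu_2$ with common reference measure $\nu$ is $$d_{\rm Hell}(\mu_1,\mu_2)=\left(\int\left(\sqrt{d\mu_1/d\nu}-\sqrt{d\mu_2/d\nu}\right)^2 d\nu\right)^{1/2}.$$ The constant $M_r$ may depend on the fixed quantities $\Gamma$, $k$, $\hat{B}$, $N$,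 $M$, $\sigma$, $\mu_0$, but not on $U_1,U_2$ other than through $r$. *)

theory Defs
  imports "HOL-Probability.Probability"
begin

section \<open>Functions on the unit circle\<close>

text \<open>Arc length on the unit circle, as a complete measure on the plane that is concentrated on
  \<open>sphere 0 1\<close>.\<close>

definition arc_length :: "(real^2) measure" where
  "arc_length = completion
     (distr (restrict_space lborel {0..<2 * pi}) borel (\<lambda>t. vector [cos t, sin t]))"

abbreviation arc_length_on :: "(real^2) set \<Rightarrow> (real^2) measure" where
  "arc_length_on \<Gamma> \<equiv> restrict_space arc_length \<Gamma>"

text \<open>Elements of \<open>L\<^sup>2\<close> are represented by functions instead of classes modulo equality almost
  everywhere; everything below depends on the class only.\<close>

definition L2_space :: "'a measure \<Rightarrow> ('a \<Rightarrow> complex) set" where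
  "L2_space \<Omega> = {f \<in> borel_measurable \<Omega>. integrable \<Omega> (\<lambda>x. (cmod (f x))\<^sup>2)}"

definition L2_norm :: "'a measure \<Rightarrow> ('a \<Rightarrow> complex) \<Rightarrow> real" where
  "L2_norm \<Omega> f = sqrt (\<integral>x. (cmod (f x))\<^sup>2 \<partial>\<Omega>)"

section \<open>Dirichlet eigenfunctions of a disc\<close>

definition bessel_J :: "nat \<Rightarrow> real \<Rightarrow> real" where
  "bessel_J n x = (\<Sum>j. (- 1) ^ j / (fact j * fact (n + j)) * (x / 2) ^ (2 * j + n))"

text \<open>The \<open>m\<close>-th positive zero of \<open>bessel_J n\<close>, counted from \<open>m = 1\<close>.\<close>

definition bessel_zero :: "nat \<Rightarrow> nat \<Rightarrow> real" where
  "bessel_zero m n = (THE x. 0 < x \<and> bessel_J n x = 0 \<and>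
     card {y. 0 < y \<and> y \<le> x \<and> bessel_J n y = 0} = m)"

definition polar_angle :: "real^2 \<Rightarrow> real" where
  "polar_angle x = Arg (Complex (x $ 1) (x $ 2))"

definition radial_part :: "real^2 \<Rightarrow> real \<Rightarrow> nat \<Rightarrow> nat \<Rightarrow> real^2 \<Rightarrow> real" where
  "radial_part c R m n x = 1 / (sqrt pi * R * bessel_J (n + 1) (bessel_zero m n))
     * bessel_J n (bessel_zero m n * norm (x - c) / R)"

definition Q1 :: "real^2 \<Rightarrow> real \<Rightarrow> nat \<Rightarrow> nat \<Rightarrow> real^2 \<Rightarrow> real" where
  "Q1 c R m n x = radial_part c R m n x * cos (real n * polar_angle (x - c))"

definition Q2 :: "real^2 \<Rightarrow> real \<Rightarrow> nat \<Rightarrow> nat \<Rightarrow> real^2 \<Rightarrow> real" where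
  "Q2 c R m n x = radial_part c R m n x * sin (real n * polar_angle (x - c))"

section \<open>Coefficient space and forward operator\<close>

text \<open>\<open>Inl (m, n)\<close> indexes the cosine coefficient \<open>A\<^sup>1\<close> and \<open>Inr (m, n)\<close> the sine
  coefficient \<open>A\<^sup>2\<close>.\<close>

type_synonym coeff_index = "(nat \<times> nat) + (nat \<times> nat)"

definition coeff_indices :: "nat \<Rightarrow> nat \<Rightarrow> coeff_index set" where
  "coeff_indices M N = ({1..M} \<times> {0..N}) <+> ({1..M} \<times> {1..N})"

lemma card_coeff_indices: "card (coeff_indices M N) = (2 * N + 1) * M"
  by (simp add: coeff_indices_def card_Plus algebra_simps)

text \<open>The Borel space \<open>\<real>\<^bsup>(2N+1)M\<^esup>\<close>, realised as the extensional functions on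
  \<open>coeff_indices M N\<close>.\<close>

definition coeff_space :: "nat \<Rightarrow> nat \<Rightarrow> (coeff_index \<Rightarrow> real) measure" where
  "coeff_space M N = (\<Pi>\<^sub>M i\<in>coeff_indices M N. borel)"

definition f_BE :: "real^2 \<Rightarrow> real \<Rightarrow> nat \<Rightarrow> nat \<Rightarrow> (coeff_index \<Rightarrow> real) \<Rightarrow> real^2 \<Rightarrow> real" where
  "f_BE c R M N A x = (\<Sum>m=1..M. (\<Sum>n=0..N. A (Inl (m, n)) * Q1 c R m n x)
     + (\<Sum>n=1..N. A (Inr (m, n)) * Q2 c R m n x))"

definition forward_op ::
    "real^2 \<Rightarrow> real \<Rightarrow> nat \<Rightarrow> nat \<Rightarrow> real \<Rightarrow> (coeff_index \<Rightarrow> real) \<Rightarrow> real^2 \<Rightarrow> complex" where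
  "forward_op c R M N k A xh = (LINT y:ball c R|lborel.
     exp (- \<i> * complex_of_real (k * (xh \<bullet> y))) * complex_of_real (f_BE c R M N A y))"

section \<open>Bayesian inversion\<close>

definition misfit ::
    "(real^2) set \<Rightarrow> real^2 \<Rightarrow> real \<Rightarrow> nat \<Rightarrow> nat \<Rightarrow> real \<Rightarrow> real \<Rightarrow>
     (coeff_index \<Rightarrow> real) \<Rightarrow> (real^2 \<Rightarrow> complex) \<Rightarrow> real" where
  "misfit \<Gamma> c R M N k \<sigma> A U = 1 / (2 * \<sigma>\<^sup>2) *
     (L2_norm (arc_length_on \<Gamma>) (\<lambda>xh. U xh - forward_op c R M N k A xh))\<^sup>2"

definition evidence ::
    "(real^2) set \<Rightarrow> real^2 \<Rightarrow> real \<Rightarrow> nat \<Rightarrow> nat \<Rightarrow> real \<Rightarrow> real \<Rightarrow>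
     (coeff_index \<Rightarrow> real) measure \<Rightarrow> (real^2 \<Rightarrow> complex) \<Rightarrow> real" where
  "evidence \<Gamma> c R M N k \<sigma> \<mu>0 U = (\<integral>A. exp (- misfit \<Gamma> c R M N k \<sigma> A U) \<partial>\<mu>0)"

definition real_gaussian :: "real measure \<Rightarrow> bool" where
  "real_gaussian \<mu> \<longleftrightarrow> (\<exists>a. \<mu> = return borel a) \<or>
     (\<exists>a s. 0 < s \<and> \<mu> = density lborel (\<lambda>x. ennreal (normal_density a s x)))"

text \<open>A Borel measure on \<open>\<real>\<^sup>I\<close> (\<open>I\<close> finite) is Gaussian if its image under every linear functional
  is Gaussian on the line. The mean is arbitrary, and degenerate covariances are allowed.\<close>

definition gaussian_measure :: "'i set \<Rightarrow> ('i \<Rightarrow> real) measure \<Rightarrow> bool" where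
  "gaussian_measure I \<mu> \<longleftrightarrow> sets \<mu> = sets (\<Pi>\<^sub>M i\<in>I. (borel :: real measure)) \<and>
     (\<forall>a :: 'i \<Rightarrow> real. real_gaussian (distr \<mu> borel (\<lambda>A. \<Sum>i\<in>I. a i * A i)))"

definition common_reference :: "'a measure \<Rightarrow> 'a measure \<Rightarrow> 'a measure \<Rightarrow> bool" where
  "common_reference \<nu> \<mu>1 \<mu>2 \<longleftrightarrow> sigma_finite_measure \<nu> \<and>
     sets \<mu>1 = sets \<nu> \<and> sets \<mu>2 = sets \<nu> \<and>
     absolutely_continuous \<nu> \<mu>1 \<and> absolutely_continuous \<nu> \<mu>2"

definition hellinger_dist :: "'a measure \<Rightarrow> 'a measure \<Rightarrow> 'a measure \<Rightarrow> real" where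
  "hellinger_dist \<nu> \<mu>1 \<mu>2 = sqrt (\<integral>x. (sqrt (enn2real (RN_deriv \<nu> \<mu>1 x))
     - sqrt (enn2real (RN_deriv \<nu> \<mu>2 x)))\<^sup>2 \<partial>\<nu>)"

end

theory Submission
  imports Defs
begin

text \<open>The densities of the posteriors are \<open>e\<^sub>U\<^sup>2 / \<integral> e\<^sub>U\<^sup>2 d\<mu>\<^sub>0\<close> with
  \<open>e\<^sub>U(A) = exp (- \<parallel>U - F(A)\<parallel>\<^sup>2 / (4 \<sigma>\<^sup>2))\<close>. Since \<open>s \<mapsto> exp (- s\<^sup>2 / (4 \<sigma>\<^sup>2))\<close> is globally Lipschitz,
  \<open>\<bar>e\<^sub>U(A) - e\<^sub>V(A)\<bar>\<close> is bounded by a multiple of \<open>\<parallel>U - V\<parallel>\<close> uniformly in \<open>A\<close>, so no integrability of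
  \<open>\<parallel>F(A)\<parallel>\<close> with respect to the prior is needed. On a ball of data the evidence is bounded away from \<open>0\<close>,
  because \<open>\<parallel>U - F(A)\<parallel>\<^sup>2 \<le> 2 r\<^sup>2 + 2 \<parallel>F(A)\<parallel>\<^sup>2\<close>; hence normalisation preserves the Lipschitz bound.\<close>

section \<open>Square integrable functions\<close>

lemma L2_space_diff:
  assumes "f \<in> L2_space M" "g \<in> L2_space M"
  shows "(\<lambda>x. f x - g x) \<in> L2_space M"
proof -
  have [measurable]: "f \<in> borel_measurable M" "g \<in> borel_measurable M"
    and f: "integrable M (\<lambda>x. (cmod (f x))\<^sup>2)" and g: "integrable M (\<lambda>x. (cmod (g x))\<^sup>2)"
    using assms by (auto simp: L2_space_def)
  have le: "(cmod (f x - g x))\<^sup>2 \<le> 2 * (cmod (f x))\<^sup>2 + 2 * (cmod (g x))\<^sup>2" for x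
  proof -
    have "(cmod (f x - g x))\<^sup>2 \<le> (cmod (f x) + cmod (g x))\<^sup>2"
      by (intro power_mono norm_triangle_ineq4) auto
    also have "\<dots> \<le> 2 * (cmod (f x))\<^sup>2 + 2 * (cmod (g x))\<^sup>2"
      using sum_squares_bound[of "cmod (f x)" "cmod (g x)"] by (simp add: power2_sum)
    finally show ?thesis .
  qed
  have "integrable M (\<lambda>x. (cmod (f x - g x))\<^sup>2)"
  proof (rule Bochner_Integration.integrable_bound[OF _ _ AE_I2])
    show "integrable M (\<lambda>x. 2 * (cmod (f x))\<^sup>2 + 2 * (cmod (g x))\<^sup>2)"
      using f g by simp
    show "norm ((cmod (f x - g x))\<^sup>2) \<le> norm (2 * (cmod (f x))\<^sup>2 + 2 * (cmod (g x))\<^sup>2)" for x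
      using order_trans[OF le[of x] abs_ge_self] by simp
  qed simp
  then show ?thesis
    by (auto simp: L2_space_def)
qed

lemma L2_norm_nonneg: "0 \<le> L2_norm M f"
  by (simp add: L2_norm_def)

lemma L2_norm_power2: "(L2_norm M f)\<^sup>2 = (\<integral>x. (cmod (f x))\<^sup>2 \<partial>M)"
  by (simp add: L2_norm_def)

lemma L2_norm_minus_commute: "L2_norm M (\<lambda>x. f x - g x) = L2_norm M (\<lambda>x. g x - f x)"
  by (simp add: L2_norm_def norm_minus_commute)

text \<open>Minkowski's inequality, obtained from \<open>(a + b)\<^sup>2 \<le> a\<^sup>2 (G + H) / G + b\<^sup>2 (G + H) / H\<close> with
  \<open>G\<close>, \<open>H\<close> slightly larger than the norms.\<close>

lemma L2_norm_triangle:
  assumes f: "f \<in> L2_space M" and g: "g \<in> L2_space M" and h: "h \<in> L2_space M"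
    and le: "\<And>x. x \<in> space M \<Longrightarrow> cmod (f x) \<le> cmod (g x) + cmod (h x)"
  shows "L2_norm M f \<le> L2_norm M g + L2_norm M h"
proof (rule field_le_epsilon)
  fix e :: real assume e: "0 < e"
  define G where "G = L2_norm M g + e / 2"
  define H where "H = L2_norm M h + e / 2"
  have GH: "0 < G" "0 < H" "L2_norm M g \<le> G" "L2_norm M h \<le> H"
    using e L2_norm_nonneg[of M g] L2_norm_nonneg[of M h] by (simp_all add: G_def H_def)
  have amgm: "(a + b)\<^sup>2 \<le> (G + H) / G * a\<^sup>2 + (G + H) / H * b\<^sup>2" for a b :: real
  proof -
    \<comment> \<open>Scaling by \<open>G\<close> and \<open>H\<close> turns the difference of the
      two sides into the nonnegative term \<open>G * H * (u - v)^2\<close>.\<close>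
    obtain u v where "a = G * u" "b = H * v"
      using GH by (metis less_irrefl nonzero_mult_div_cancel_left times_divide_eq_right)
    then have "(G + H) / G * a\<^sup>2 + (G + H) / H * b\<^sup>2 - (a + b)\<^sup>2 = (G * H) * (u - v)\<^sup>2"
      using GH by (simp add: power2_eq_square algebra_simps add_divide_distrib)
    moreover have "0 \<le> (G * H) * (u - v)\<^sup>2" using GH by simp
    ultimately show ?thesis by linarith
  qed
  have int: "integrable M (\<lambda>x. (cmod (f x))\<^sup>2)" "integrable M (\<lambda>x. (cmod (g x))\<^sup>2)"
    "integrable M (\<lambda>x. (cmod (h x))\<^sup>2)"
    using f g h by (auto simp: L2_space_def)
  have "(L2_norm M f)\<^sup>2 \<le> (\<integral>x. (G + H) / G * (cmod (g x))\<^sup>2 + (G + H) / H * (cmod (h x))\<^sup>2 \<partial>M)"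
    unfolding L2_norm_power2
  proof (rule integral_mono)
    fix x assume "x \<in> space M"
    then have "(cmod (f x))\<^sup>2 \<le> (cmod (g x) + cmod (h x))\<^sup>2"
      by (intro power_mono le) auto
    also note amgm
    finally show "(cmod (f x))\<^sup>2 \<le> (G + H) / G * (cmod (g x))\<^sup>2 + (G + H) / H * (cmod (h x))\<^sup>2" .
  qed (use int in auto)
  also have "\<dots> = (G + H) / G * (L2_norm M g)\<^sup>2 + (G + H) / H * (L2_norm M h)\<^sup>2"
    unfolding L2_norm_power2 using int by simp
  also have "\<dots> \<le> (G + H) / G * G\<^sup>2 + (G + H) / H * H\<^sup>2"
    using GH L2_norm_nonneg by (intro add_mono mult_left_mono power_mono) auto
  also have "\<dots> = (G + H)\<^sup>2"
    using GH by (simp add: power2_eq_square algebra_simps add_divide_distrib)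
  finally have "L2_norm M f \<le> G + H"
    by (rule power2_le_imp_le) (use GH in simp)
  then show "L2_norm M f \<le> L2_norm M g + L2_norm M h + e"
    by (simp add: G_def H_def)
qed

lemma L2_norm_reverse_triangle:
  assumes "f \<in> L2_space M" "g \<in> L2_space M"
  shows "\<bar>L2_norm M f - L2_norm M g\<bar> \<le> L2_norm M (\<lambda>x. f x - g x)"
proof -
  have "L2_norm M f \<le> L2_norm M g + L2_norm M (\<lambda>x. f x - g x)" if "f \<in> L2_space M" "g \<in> L2_space M" for f g
    using that by (intro L2_norm_triangle L2_space_diff norm_triangle_sub)
  from this[of f g] this[of g f] show ?thesis
    using assms L2_norm_minus_commute[of M f g] by linarith
qed

lemma (in finite_measure) L2_space_bounded:
  assumes "f \<in> borel_measurable M" "\<And>x. x \<in> space M \<Longrightarrow> cmod (f x) \<le> B"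
  shows "f \<in> L2_space M"
proof -
  have "integrable M (\<lambda>x. (cmod (f x))\<^sup>2)"
    using assms by (intro integrable_const_bound[where B="B\<^sup>2"] AE_I2) (auto intro!: power_mono)
  then show ?thesis
    using assms by (simp add: L2_space_def)
qed

section \<open>The forward operator\<close>

text \<open>The total mass is the length of the parameter interval, and completion does not change
  it. Finiteness is what places bounded measurable functions on \<open>\<Gamma>\<close> in
  \<open>L2_space\<close>.\<close>

lemma finite_measure_arc_length: "finite_measure arc_length"
proof (rule finite_measureI)
  let ?g = "\<lambda>t. vector [cos t, sin t] :: real^2"
  \<comment> \<open>Continuity of the parametrisation is checked coordinate by coordinate, so
    \<open>vector\<close> is rewritten as a componentwise function.\<close>
  have "?g = (\<lambda>t. \<chi> i. if i = 1 then cos t else sin t)"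
    by (simp add: fun_eq_iff vec_eq_iff forall_2)
  moreover have "continuous_on UNIV (\<lambda>t. (\<chi> i. if i = 1 then cos t else sin t) :: real^2)"
  proof (rule continuous_on_vec_lambda)
    show "continuous_on UNIV (\<lambda>t. (if i = 1 then cos t else sin t) :: real)" for i :: 2
      by (cases "i = 1") (simp_all add: continuous_on_cos continuous_on_sin)
  qed
  ultimately have "continuous_on UNIV ?g"
    by (simp only:)
  then have "?g \<in> borel_measurable borel"
    by (rule borel_measurable_continuous_onI)
  then have "?g \<in> borel_measurable (restrict_space lborel {0..<2 * pi})"
    by (simp add: measurable_restrict_space1)
  then show "emeasure arc_length (space arc_length) \<noteq> \<infinity>"
    by (simp add: arc_length_def emeasure_distr emeasure_restrict_space)
qed

lemma borel_measurable_arc_length_on: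
  assumes "f \<in> borel_measurable borel"
  shows "f \<in> borel_measurable (arc_length_on \<Gamma>)"
  unfolding arc_length_def using assms
  by (intro measurable_restrict_space1 measurable_completion) simp

section \<open>Measurability and boundedness of the eigenfunctions\<close>

lemma borel_measurable_Arg [measurable]: "Arg \<in> borel_measurable borel"
proof -
  have "Arg z = pi" if "z \<in> \<real>\<^sub>\<le>\<^sub>0" "z \<noteq> 0" for z
    using that by (auto simp: complex_nonpos_Reals_iff Arg_eq_pi complex_eq_iff)
  \<comment> \<open>\<open>Arg\<close> is continuous off the closed nonpositive real axis. On that
    axis it is \<open>pi\<close>, except at the origin, where its value is \<open>0\<close> by
    convention; so it is glued from measurable pieces along closed sets.\<close>
  then have eq: "Arg = (\<lambda>z. if z \<in> \<real>\<^sub>\<le>\<^sub>0 then (if z = 0 then 0 else pi) else indicator (- \<real>\<^sub>\<le>\<^sub>0) z *\<^sub>R Arg z)"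
    by (auto simp: fun_eq_iff indicator_def Arg_zero)
  have [measurable]: "(\<real>\<^sub>\<le>\<^sub>0 :: complex set) \<in> sets borel"
    by (intro borel_closed closed_nonpos_Reals_complex)
  have [measurable]: "(\<lambda>z. indicator (- \<real>\<^sub>\<le>\<^sub>0) z *\<^sub>R Arg z) \<in> borel_measurable borel"
    by (intro borel_measurable_continuous_on_indicator continuous_on_Arg) auto
  show ?thesis
    by (subst eq) measurable
qed

lemma borel_measurable_vec_nth [measurable]: "(\<lambda>x :: real^'n. x $ i) \<in> borel_measurable borel"
  by (intro borel_measurable_continuous_onI continuous_intros)

lemma borel_measurable_polar_angle [measurable]: "polar_angle \<in> borel_measurable borel"
  unfolding polar_angle_def Complex_eq by measurable

lemma borel_measurable_bessel_J [measurable]: "bessel_J n \<in> borel_measurable borel"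
  unfolding bessel_J_def by measurable

text \<open>Since \<open>fact (n + j)\<close> is at least 1, the terms are dominated by those of
  \<open>(b / 2) ^ n\<close> times the exponential series at \<open>(b / 2)^2\<close>. The
  comparison also yields absolute convergence.\<close>

lemma bessel_J_bound:
  assumes "\<bar>x\<bar> \<le> b"
  shows "\<bar>bessel_J n x\<bar> \<le> (b / 2) ^ n * exp ((b / 2)\<^sup>2)"
proof -
  let ?a = "\<lambda>j. (- 1) ^ j / (fact j * fact (n + j)) * (x / 2) ^ (2 * j + n)"
  let ?b = "\<lambda>j. (b / 2) ^ n * (((b / 2)\<^sup>2) ^ j /\<^sub>R fact j)"
  have b: "0 \<le> b" using assms by linarith
  have sums: "?b sums ((b / 2) ^ n * exp ((b / 2)\<^sup>2))"
    by (intro sums_mult exp_converges)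
  have le: "norm (?a j) \<le> ?b j" for j
  proof -
    have "norm (?a j) = \<bar>x / 2\<bar> ^ (2 * j + n) / (fact j * fact (n + j))"
      by (simp add: abs_mult power_abs)
    also have "\<dots> \<le> (b / 2) ^ (2 * j + n) / (fact j * 1)"
      using assms b by (intro frac_le power_mono mult_left_mono) auto
    also have "(b / 2) ^ (2 * j + n) = (b / 2) ^ n * ((b / 2)\<^sup>2) ^ j"
      unfolding power_add power_mult by (rule mult.commute)
    also have "\<dots> / (fact j * 1) = ?b j"
      by (simp only: real_scaleR_def divide_inverse mult_1_left mult_1_right mult_ac)
    finally show ?thesis .
  qed
  have summ: "summable (\<lambda>j. norm (?a j))"
    by (rule summable_comparison_test'[OF sums_summable[OF sums], of 0]) (rule order_trans[OF _ le], simp)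
  then have "norm (bessel_J n x) \<le> (\<Sum>j. norm (?a j))"
    unfolding bessel_J_def by (rule summable_norm)
  also have "\<dots> \<le> (\<Sum>j. ?b j)"
    by (rule suminf_le[OF le summ sums_summable[OF sums]])
  also have "\<dots> = (b / 2) ^ n * exp ((b / 2)\<^sup>2)"
    by (rule sums_unique[OF sums, symmetric])
  finally show ?thesis by simp
qed

lemma borel_measurable_Q [measurable]:
  "Q1 c R m n \<in> borel_measurable borel" "Q2 c R m n \<in> borel_measurable borel"
  unfolding Q1_def Q2_def radial_part_def by measurable

text \<open>On the disc \<open>norm (x - c) / R\<close> is at most 1, so the Bessel argument stays
  within \<open>\<bar>bessel_zero m n\<bar>\<close> and \<open>bessel_J_bound\<close> applies with
  that radius.\<close>

lemma radial_part_bounded: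
  assumes "0 < R"
  shows "\<exists>B. \<forall>x\<in>ball c R. \<bar>radial_part c R m n x\<bar> \<le> B"
proof -
  let ?q = "bessel_zero m n"
  let ?C = "\<bar>1 / (sqrt pi * R * bessel_J (n + 1) ?q)\<bar>"
  have "\<bar>radial_part c R m n x\<bar> \<le> ?C * ((\<bar>?q\<bar> / 2) ^ n * exp ((\<bar>?q\<bar> / 2)\<^sup>2))"
    if "x \<in> ball c R" for x
  proof -
    have "norm (x - c) \<le> R"
      using that by (simp add: dist_norm norm_minus_commute)
    then have "\<bar>?q\<bar> * norm (x - c) \<le> \<bar>?q\<bar> * R"
      by (intro mult_left_mono) auto
    then have "\<bar>?q * norm (x - c) / R\<bar> \<le> \<bar>?q\<bar>"
      using assms by (simp add: abs_mult field_simps)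
    then show ?thesis
      unfolding radial_part_def abs_mult by (intro mult_left_mono bessel_J_bound) auto
  qed
  then show ?thesis by blast
qed

text \<open>A single family over the coefficient indices, so that \<open>f_BE\<close> and the
  forward operator become one finite linear combination.\<close>

fun eigenfunction :: "real^2 \<Rightarrow> real \<Rightarrow> coeff_index \<Rightarrow> real^2 \<Rightarrow> real" where
  "eigenfunction c R (Inl (m, n)) = Q1 c R m n"
| "eigenfunction c R (Inr (m, n)) = Q2 c R m n"

lemma borel_measurable_eigenfunction [measurable]: "eigenfunction c R i \<in> borel_measurable borel"
  by (cases "(c, R, i)" rule: eigenfunction.cases) auto

lemma eigenfunction_bounded:
  assumes "0 < R"
  shows "\<exists>B. \<forall>x\<in>ball c R. \<bar>eigenfunction c R i x\<bar> \<le> B"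
proof -
  have *: "\<bar>a * b\<bar> \<le> B" if "\<bar>a\<bar> \<le> B" "\<bar>b\<bar> \<le> 1" for a b B :: real
    using mult_mono[OF that] that by (auto simp: abs_mult)
  \<comment> \<open>The flag \<open>t\<close> selects cosine or sine, so that both cases share the
    bound of the radial factor.\<close>
  obtain t m n where i: "i = (if t then Inl (m, n) else Inr (m, n))"
    by (metis surj_pair sumE)
  obtain B where "\<forall>x\<in>ball c R. \<bar>radial_part c R m n x\<bar> \<le> B"
    using radial_part_bounded[OF assms] by blast
  then show ?thesis
    by (intro exI[of _ B]) (auto simp: i Q1_def Q2_def intro!: *)
qed

section \<open>Expansion of the forward operator in Fourier integrals of the eigenfunctions\<close>

lemma f_BE_eq_sum: "f_BE c R M N A x = (\<Sum>i\<in>coeff_indices M N. A i * eigenfunction c R i x)"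
proof -
  have "sum h (X \<times> Y) = (\<Sum>m\<in>X. \<Sum>n\<in>Y. h (m, n))" for h :: "nat \<times> nat \<Rightarrow> real" and X Y
    by (simp add: sum.cartesian_product)
  then show ?thesis
    by (simp add: f_BE_def coeff_indices_def sum.Plus sum.distrib)
qed

text \<open>The Fourier transform, at frequency \<open>k xh\<close>, of \<open>q\<close> cut off to
  the disc.\<close>

definition disc_fourier :: "real^2 \<Rightarrow> real \<Rightarrow> real \<Rightarrow> (real^2 \<Rightarrow> real) \<Rightarrow> real^2 \<Rightarrow> complex" where
  "disc_fourier c R k q xh =
     (LINT y:ball c R|lborel. exp (- \<i> * complex_of_real (k * (xh \<bullet> y))) * complex_of_real (q y))"

lemma borel_measurable_disc_fourier:
  assumes [measurable]: "q \<in> borel_measurable borel"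
  shows "disc_fourier c R k q \<in> borel_measurable borel"
proof -
  have [measurable]: "ball c R \<in> sets borel" by simp
  have "(\<lambda>(xh, y). indicat_real (ball c R) y *\<^sub>R
      (exp (- \<i> * complex_of_real (k * (xh \<bullet> y))) * complex_of_real (q y)))
    \<in> borel_measurable (borel \<Otimes>\<^sub>M borel)"
    by measurable
  then show ?thesis
    unfolding disc_fourier_def set_lebesgue_integral_def
    by (intro lborel.borel_measurable_lebesgue_integral)
      (simp cong: measurable_cong_sets sets_pair_measure_cong)
qed

lemma set_integrable_disc_fourier:
  assumes [measurable]: "q \<in> borel_measurable borel" and B: "\<And>y. y \<in> ball c R \<Longrightarrow> \<bar>q y\<bar> \<le> B"
  shows "set_integrable lborel (ball c R)
           (\<lambda>y. exp (- \<i> * complex_of_real (k * (xh \<bullet> y))) * complex_of_real (q y))"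
proof -
  have [measurable]: "ball c R \<in> sets borel" by simp
  show ?thesis
  proof (rule set_integrable_bound[where f="\<lambda>_. B"])
    show "set_integrable lborel (ball c R) (\<lambda>_. B)"
      using emeasure_lborel_ball_finite[of c R] by (simp add: set_integrable_def)
    show "set_borel_measurable lborel (ball c R)
      (\<lambda>y. exp (- \<i> * complex_of_real (k * (xh \<bullet> y))) * complex_of_real (q y))"
      unfolding set_borel_measurable_def by measurable
    show "AE x in lborel. x \<in> ball c R \<longrightarrow>
        norm (exp (- \<i> * complex_of_real (k * (xh \<bullet> x))) * complex_of_real (q x)) \<le> norm B"
      using B by (intro AE_I2) (force simp: norm_mult)
  qed
qed

text \<open>The exponent is purely imaginary, so the kernel has modulus 1 and the integral is at
  most the area of the disc times the bound on \<open>q\<close>.\<close>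

lemma disc_fourier_bound:
  assumes [measurable]: "q \<in> borel_measurable borel" and B: "\<And>y. y \<in> ball c R \<Longrightarrow> \<bar>q y\<bar> \<le> B"
  shows "cmod (disc_fourier c R k q xh) \<le> measure lborel (ball c R) * B"
proof -
  have "cmod (disc_fourier c R k q xh) \<le> (LINT y:ball c R|lborel. B)"
    unfolding disc_fourier_def set_lebesgue_integral_def
  proof (rule Bochner_Integration.integral_norm_bound_integral)
    show "integrable lborel (\<lambda>y. indicat_real (ball c R) y *\<^sub>R
        (exp (- \<i> * complex_of_real (k * (xh \<bullet> y))) * complex_of_real (q y)))"
      using set_integrable_disc_fourier[OF assms] by (simp add: set_integrable_def)
    show "integrable lborel (\<lambda>y. indicat_real (ball c R) y *\<^sub>R B)"
      using emeasure_lborel_ball_finite[of c R] by simp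
  qed (use B in \<open>auto simp: norm_mult indicator_def\<close>)
  also have "\<dots> = measure lborel (ball c R) * B"
    by (simp add: set_lebesgue_integral_def)
  finally show ?thesis .
qed

text \<open>Boundedness of the eigenfunctions makes every summand integrable, so sum and integral
  can be exchanged. The result separates the coefficients from the direction \<open>xh\<close>,
  which gives square integrability in \<open>xh\<close> and joint measurability in both
  variables.\<close>

lemma forward_op_eq_sum:
  assumes "0 < R"
  shows "forward_op c R M N k A xh =
    (\<Sum>i\<in>coeff_indices M N. complex_of_real (A i) * disc_fourier c R k (eigenfunction c R i) xh)"
proof -
  let ?e = "\<lambda>y. exp (- \<i> * complex_of_real (k * (xh \<bullet> y)))"
  have int: "set_integrable lborel (ball c R) (\<lambda>y. ?e y * complex_of_real (eigenfunction c R i y))" for i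
  proof -
    obtain B where "\<And>y. y \<in> ball c R \<Longrightarrow> \<bar>eigenfunction c R i y\<bar> \<le> B"
      using eigenfunction_bounded[OF assms] by blast
    then show ?thesis
      by (rule set_integrable_disc_fourier[OF borel_measurable_eigenfunction])
  qed
  have "forward_op c R M N k A xh = (LINT y:ball c R|lborel.
      (\<Sum>i\<in>coeff_indices M N. complex_of_real (A i) * (?e y * complex_of_real (eigenfunction c R i y))))"
    unfolding forward_op_def f_BE_eq_sum by (simp add: sum_distrib_left mult_ac)
  also have "\<dots> = (\<Sum>i\<in>coeff_indices M N. LINT y:ball c R|lborel.
      complex_of_real (A i) * (?e y * complex_of_real (eigenfunction c R i y)))"
    unfolding set_lebesgue_integral_def scaleR_sum_right
    by (intro Bochner_Integration.integral_sum set_integrable_mult_right[OF int, unfolded set_integrable_def])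
  finally show ?thesis
    by (simp add: disc_fourier_def)
qed

lemma forward_op_L2_space:
  assumes "0 < R" and \<Gamma>: "\<Gamma> \<in> sets arc_length"
  shows "forward_op c R M N k A \<in> L2_space (arc_length_on \<Gamma>)"
proof -
  interpret finite_measure "arc_length_on \<Gamma>"
    by (intro finite_measure_restrict_space finite_measure_arc_length \<Gamma>)
  let ?\<phi> = "\<lambda>i. disc_fourier c R k (eigenfunction c R i)"
  obtain B where B: "\<And>i x. x \<in> ball c R \<Longrightarrow> \<bar>eigenfunction c R i x\<bar> \<le> B i"
    using eigenfunction_bounded[OF assms(1)] by metis
  let ?b = "\<lambda>i. measure lborel (ball c R) * B i"
  show ?thesis
  proof (rule L2_space_bounded)
    show "forward_op c R M N k A \<in> borel_measurable (arc_length_on \<Gamma>)"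
      using borel_measurable_arc_length_on[OF borel_measurable_disc_fourier]
      unfolding forward_op_eq_sum[OF assms(1)] by (auto intro!: borel_measurable_sum borel_measurable_times)
    fix xh
    show "cmod (forward_op c R M N k A xh) \<le> (\<Sum>i\<in>coeff_indices M N. \<bar>A i\<bar> * ?b i)"
      unfolding forward_op_eq_sum[OF assms(1)]
      by (intro sum_norm_le) (auto simp: norm_mult intro!: mult_left_mono disc_fourier_bound B)
  qed
qed

section \<open>Measurability of the misfit in the coefficients\<close>

lemma borel_measurable_misfit:
  assumes "0 < R" and \<Gamma>: "\<Gamma> \<in> sets arc_length"
    and P: "sets P = sets (coeff_space M N)" and U: "U \<in> L2_space (arc_length_on \<Gamma>)"
  shows "(\<lambda>A. misfit \<Gamma> c R M N k \<sigma> A U) \<in> borel_measurable P"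
proof -
  let ?\<Omega> = "arc_length_on \<Gamma>"
  let ?\<phi> = "\<lambda>i. disc_fourier c R k (eigenfunction c R i)"
  interpret finite_measure ?\<Omega>
    by (intro finite_measure_restrict_space finite_measure_arc_length \<Gamma>)
  have [measurable]: "U \<in> borel_measurable ?\<Omega>"
    using U by (simp add: L2_space_def)
  have [measurable]: "?\<phi> i \<in> borel_measurable ?\<Omega>" for i
    by (intro borel_measurable_arc_length_on borel_measurable_disc_fourier) simp
  have [measurable]: "(\<lambda>A. A i) \<in> borel_measurable P" if "i \<in> coeff_indices M N" for i
    by (subst measurable_cong_sets[OF P refl]) (simp add: coeff_space_def that)
  \<comment> \<open>The integrand is jointly measurable, being built from finitely many products of
    a coordinate of \<open>A\<close> and a function of \<open>xh\<close>; integrating out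
    \<open>xh\<close> against a finite measure then keeps measurability in \<open>A\<close>.\<close>
  have "(\<lambda>(A, xh). (cmod (U xh - (\<Sum>i\<in>coeff_indices M N. complex_of_real (A i) * ?\<phi> i xh)))\<^sup>2)
      \<in> borel_measurable (P \<Otimes>\<^sub>M ?\<Omega>)"
    by measurable
  then show ?thesis
    unfolding misfit_def L2_norm_power2 forward_op_eq_sum[OF assms(1)]
    by (intro borel_measurable_times borel_measurable_const borel_measurable_lebesgue_integral)
qed

section \<open>Hellinger distance of normalised densities\<close>

text \<open>With \<open>y = \<bar>x\<bar> / (2 * \<sigma>)\<close> the derivative has modulus
  \<open>y * exp (- y^2) / \<sigma>\<close>, and \<open>y \<le> 1 + y^2 \<le> exp (y^2)\<close>
  bounds it by \<open>1 / \<sigma>\<close>.\<close>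

lemma gaussian_lipschitz:
  fixes s t \<sigma> :: real
  assumes "0 < \<sigma>" "0 \<le> s" "0 \<le> t"
  shows "\<bar>exp (- s\<^sup>2 / (4 * \<sigma>\<^sup>2)) - exp (- t\<^sup>2 / (4 * \<sigma>\<^sup>2))\<bar> \<le> 1 / \<sigma> * \<bar>s - t\<bar>"
proof -
  let ?f = "\<lambda>x. exp (- x\<^sup>2 / (4 * \<sigma>\<^sup>2)) :: real"
  let ?f' = "\<lambda>x. ?f x * (- (2 * x) / (4 * \<sigma>\<^sup>2))"
  have "norm (?f s - ?f t) \<le> 1 / \<sigma> * norm (s - t)"
  proof (rule field_differentiable_bound[where S = UNIV and f' = ?f'])
    fix x :: real
    show "(?f has_field_derivative ?f' x) (at x within UNIV)"
    proof -
      have "((\<lambda>x. exp (- x\<^sup>2 / d)) has_field_derivative exp (- x\<^sup>2 / d) * (- (2 * x) / d)) (at x)"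
        if "d \<noteq> 0" for d :: real
        using that by (auto intro!: derivative_eq_intros simp: field_simps power2_eq_square)
      from this[of "4 * \<sigma>\<^sup>2"] show ?thesis using assms by simp
    qed
    have "y \<le> 1 + y\<^sup>2" for y :: real
      using zero_le_power2[of "y - 1 / 2"] by (simp add: power2_diff power_divide)
    from this[of "\<bar>x\<bar> / (2 * \<sigma>)"] have "\<bar>x\<bar> / (2 * \<sigma>) \<le> 1 + x\<^sup>2 / (4 * \<sigma>\<^sup>2)"
      by (simp add: power_divide power_mult_distrib)
    also have "\<dots> \<le> exp (x\<^sup>2 / (4 * \<sigma>\<^sup>2))"
      by (rule exp_ge_add_one_self)
    finally have "?f x * (\<bar>x\<bar> / (2 * \<sigma>)) \<le> ?f x * exp (x\<^sup>2 / (4 * \<sigma>\<^sup>2))"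
      by (intro mult_left_mono) auto
    also have "\<dots> = 1"
      by (simp flip: exp_add)
    finally have "?f x * (\<bar>x\<bar> / (2 * \<sigma>)) / \<sigma> \<le> 1 / \<sigma>"
      using assms by (intro divide_right_mono) auto
    then show "norm (?f' x) \<le> 1 / \<sigma>"
      using assms by (simp add: abs_mult power2_eq_square)
  qed auto
  then show ?thesis by simp
qed

text \<open>Replaces an arbitrary reference \<open>\<nu>\<close> by \<open>P\<close>. Positivity of
  \<open>h1\<close> makes sets that are null for its density null for \<open>P\<close>, so
  \<open>P\<close> has a density \<open>w\<close> with respect to \<open>\<nu>\<close>. The chain
  rule gives the densities \<open>w * h1\<close> and \<open>w * h2\<close>; the common factor
  \<open>w\<close> leaves the square and turns \<open>\<nu>\<close> back into
  \<open>P\<close>.\<close>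

lemma hellinger_dist_density:
  assumes P: "sigma_finite_measure P"
    and [measurable]: "h1 \<in> borel_measurable P" "h2 \<in> borel_measurable P"
    and pos: "\<And>x. 0 < h1 x" "\<And>x. 0 < h2 x"
    and \<nu>: "common_reference \<nu> (density P (\<lambda>x. ennreal (h1 x))) (density P (\<lambda>x. ennreal (h2 x)))"
  shows "hellinger_dist \<nu> (density P (\<lambda>x. ennreal (h1 x))) (density P (\<lambda>x. ennreal (h2 x)))
    = sqrt (\<integral>x. (sqrt (h1 x) - sqrt (h2 x))\<^sup>2 \<partial>P)"
proof -
  have sf: "sigma_finite_measure \<nu>" and sets: "sets P = sets \<nu>"
    and ac1: "absolutely_continuous \<nu> (density P (\<lambda>x. ennreal (h1 x)))"
    using \<nu> by (auto simp: common_reference_def)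
  interpret \<nu>: sigma_finite_measure \<nu> by fact
  have "absolutely_continuous (density P (\<lambda>x. ennreal (h1 x))) P"
    unfolding absolutely_continuous_def
  proof
    fix A assume "A \<in> null_sets (density P (\<lambda>x. ennreal (h1 x)))"
    then have A: "A \<in> sets P" and "AE x in P. x \<in> A \<longrightarrow> ennreal (h1 x) = 0"
      by (auto simp: null_sets_density_iff)
    from this(2) have "AE x in P. x \<notin> A"
      by eventually_elim (use pos(1) in \<open>auto simp: ennreal_eq_0_iff not_le[symmetric]\<close>)
    with A show "A \<in> null_sets P"
      by (simp add: AE_iff_null_sets)
  qed
  then have ac: "absolutely_continuous \<nu> P"
    using ac1 by (auto simp: absolutely_continuous_def)
  define w where "w = RN_deriv \<nu> P"
  have [measurable]: "w \<in> borel_measurable \<nu>" by (simp add: w_def)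
  have dens: "density \<nu> w = P"
    unfolding w_def by (intro \<nu>.density_RN_deriv ac sets)
  \<comment> \<open>Sigma-finiteness of \<open>P\<close> gives finiteness of \<open>w\<close> almost
    everywhere, so that the real-valued version of \<open>w\<close> defines the same
    measure.\<close>
  have fin: "AE x in \<nu>. w x \<noteq> \<infinity>"
    unfolding w_def by (intro \<nu>.RN_deriv_finite P ac sets)
  have meas: "f \<in> borel_measurable \<nu>" if "f \<in> borel_measurable P" for f :: "'a \<Rightarrow> real"
    using that by (simp cong: measurable_cong_sets add: sets)
  have [measurable]: "h1 \<in> borel_measurable \<nu>" "h2 \<in> borel_measurable \<nu>"
    by (auto intro: meas)
  have rn: "AE x in \<nu>. w x * ennreal (h x) = RN_deriv \<nu> (density P (\<lambda>x. ennreal (h x))) x"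
    if [measurable]: "h \<in> borel_measurable \<nu>" for h :: "'a \<Rightarrow> real"
    by (rule \<nu>.RN_deriv_unique) (auto simp: dens[symmetric] density_density_eq)
  have "(\<integral>x. (sqrt (enn2real (RN_deriv \<nu> (density P (\<lambda>x. ennreal (h1 x))) x))
      - sqrt (enn2real (RN_deriv \<nu> (density P (\<lambda>x. ennreal (h2 x))) x)))\<^sup>2 \<partial>\<nu>)
    = (\<integral>x. enn2real (w x) *\<^sub>R (sqrt (h1 x) - sqrt (h2 x))\<^sup>2 \<partial>\<nu>)"
  proof (rule integral_cong_AE)
    show "AE x in \<nu>. (sqrt (enn2real (RN_deriv \<nu> (density P (\<lambda>x. ennreal (h1 x))) x))
      - sqrt (enn2real (RN_deriv \<nu> (density P (\<lambda>x. ennreal (h2 x))) x)))\<^sup>2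
      = enn2real (w x) *\<^sub>R (sqrt (h1 x) - sqrt (h2 x))\<^sup>2"
      using rn[of h1, simplified] rn[of h2, simplified]
    proof eventually_elim
      case (elim x)
      have "sqrt (enn2real (w x * ennreal (h x))) = sqrt (enn2real (w x)) * sqrt (h x)"
        if "0 < h x" for h
        using that by (simp add: enn2real_mult real_sqrt_mult)
      then show ?case
        using elim pos by (simp add: power_mult_distrib flip: elim right_diff_distrib)
    qed
  qed auto
  also have "\<dots> = (\<integral>x. (sqrt (h1 x) - sqrt (h2 x))\<^sup>2 \<partial>density \<nu> (\<lambda>x. ennreal (enn2real (w x))))"
    by (rule integral_density[symmetric]) auto
  also have "density \<nu> (\<lambda>x. ennreal (enn2real (w x))) = density \<nu> w"
    using fin by (intro density_cong) (auto simp: less_top)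
  finally show ?thesis
    by (simp add: hellinger_dist_def dens)
qed

text \<open>The difference splits into \<open>(e1 - e2) / sqrt L1\<close> and
  \<open>e2 * (sqrt L2 - sqrt L1) / (sqrt L1 * sqrt L2)\<close>. The lower bound \<open>c\<close>
  controls the denominators and produces the two summands of the constant.\<close>

lemma normalised_diff_le:
  fixes c L1 L2 e1 e2 \<delta> :: real
  assumes c: "0 < c" and L: "c \<le> L1" "c \<le> L2" and e: "0 \<le> e2" "e2 \<le> 1"
    and "\<bar>e1 - e2\<bar> \<le> \<delta>" "\<bar>L1 - L2\<bar> \<le> 2 * \<delta>"
  shows "\<bar>e1 / sqrt L1 - e2 / sqrt L2\<bar> \<le> (1 / sqrt c + 1 / (c * sqrt c)) * \<delta>"
proof -
  let ?s = "sqrt c" and ?a = "sqrt L1" and ?b = "sqrt L2"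
  have s: "0 < ?s" "?s \<le> ?a" "?s \<le> ?b" "c = ?s * ?s" using c L by simp_all
  have ab: "0 < ?a" "0 < ?b" "c \<le> ?a * ?b"
    using s mult_mono[of ?s ?a ?s ?b] by auto
  have \<delta>: "0 \<le> \<delta>" using assms by linarith
  \<comment> \<open>Multiplying by the conjugate sum, which is at least \<open>2 * sqrt c\<close>,
    turns the difference of roots into \<open>L2 - L1\<close>; the 2 cancels the one in
    \<open>2 * \<delta>\<close>.\<close>
  have "\<bar>?b - ?a\<bar> * (2 * ?s) \<le> \<bar>?b - ?a\<bar> * (?a + ?b)"
    using s(2,3) by (intro mult_left_mono) linarith+
  also have "\<dots> = \<bar>(?b - ?a) * (?a + ?b)\<bar>"
    using ab by (simp add: abs_mult)
  also have "(?b - ?a) * (?a + ?b) = L2 - L1"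
    using c L by (simp add: algebra_simps)
  finally have "\<bar>?b - ?a\<bar> \<le> \<delta> / ?s"
    using assms s by (simp add: field_simps abs_minus_commute)
  then have "e2 * \<bar>?b - ?a\<bar> / (?a * ?b) \<le> 1 * (\<delta> / ?s) / c"
    using e c s ab \<delta> by (intro frac_le mult_mono) auto
  moreover have "\<bar>e1 - e2\<bar> / ?a \<le> \<delta> / ?s"
    using assms s \<delta> by (intro frac_le) auto
  moreover have "e1 / ?a - e2 / ?b = (e1 - e2) / ?a + e2 * (?b - ?a) / (?a * ?b)"
    using ab by (simp add: field_simps)
  then have "\<bar>e1 / ?a - e2 / ?b\<bar> \<le> \<bar>e1 - e2\<bar> / ?a + e2 * \<bar>?b - ?a\<bar> / (?a * ?b)"
    using abs_triangle_ineq[of "(e1 - e2) / ?a" "e2 * (?b - ?a) / (?a * ?b)"] e ab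
    by (simp add: abs_mult)
  ultimately show ?thesis
    by (simp add: field_simps)
qed

text \<open>Here \<open>e1\<close> and \<open>e2\<close> are square roots of the unnormalised
  densities, the quantities that the Hellinger distance compares, and the normalising constants are
  the integrals of their squares.\<close>

lemma hellinger_dist_normalised_le:
  fixes e1 e2 :: "'a \<Rightarrow> real"
  assumes "prob_space P" and [measurable]: "e1 \<in> borel_measurable P" "e2 \<in> borel_measurable P"
    and e1: "\<And>x. 0 < e1 x" "\<And>x. e1 x \<le> 1" and e2: "\<And>x. 0 < e2 x" "\<And>x. e2 x \<le> 1"
    and diff: "\<And>x. \<bar>e1 x - e2 x\<bar> \<le> \<delta>"
    and c: "0 < c" "c \<le> (\<integral>x. (e1 x)\<^sup>2 \<partial>P)" "c \<le> (\<integral>x. (e2 x)\<^sup>2 \<partial>P)"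
    and \<mu>1: "\<mu>1 = density P (\<lambda>x. ennreal (1 / (\<integral>x. (e1 x)\<^sup>2 \<partial>P) * (e1 x)\<^sup>2))"
    and \<mu>2: "\<mu>2 = density P (\<lambda>x. ennreal (1 / (\<integral>x. (e2 x)\<^sup>2 \<partial>P) * (e2 x)\<^sup>2))"
    and \<nu>: "common_reference \<nu> \<mu>1 \<mu>2"
  shows "hellinger_dist \<nu> \<mu>1 \<mu>2 \<le> (1 / sqrt c + 1 / (c * sqrt c)) * \<delta>"
proof -
  interpret prob_space P by fact
  let ?L1 = "\<integral>x. (e1 x)\<^sup>2 \<partial>P" and ?L2 = "\<integral>x. (e2 x)\<^sup>2 \<partial>P"
  let ?K = "(1 / sqrt c + 1 / (c * sqrt c)) * \<delta>"
  have \<delta>: "0 \<le> \<delta>" using diff[of undefined] by linarith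
  have int: "integrable P (\<lambda>x. (e1 x)\<^sup>2)" "integrable P (\<lambda>x. (e2 x)\<^sup>2)"
    using e1 e2 by (auto intro!: integrable_const_bound[where B=1] AE_I2 power_le_one
        simp: less_imp_le)
  have sq: "\<bar>(e1 x)\<^sup>2 - (e2 x)\<^sup>2\<bar> \<le> 2 * \<delta>" for x
  proof -
    have "\<bar>(e1 x)\<^sup>2 - (e2 x)\<^sup>2\<bar> = \<bar>e1 x - e2 x\<bar> * (e1 x + e2 x)"
      using e1(1)[of x] e2(1)[of x] by (simp add: square_diff_square_factored power2_eq_square abs_mult)
    \<comment> \<open>Both values are at most 1, so their sum is at most 2; this is the factor in
      the bound on the evidences.\<close>
    also have "\<dots> \<le> \<delta> * 2"
      using e1[of x] e2[of x] diff[of x] \<delta> by (intro mult_mono) auto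
    finally show ?thesis by simp
  qed
  have "\<bar>?L1 - ?L2\<bar> = \<bar>\<integral>x. (e1 x)\<^sup>2 - (e2 x)\<^sup>2 \<partial>P\<bar>"
    using int by simp
  also have "\<dots> \<le> (\<integral>x. \<bar>(e1 x)\<^sup>2 - (e2 x)\<^sup>2\<bar> \<partial>P)"
    by (rule integral_abs_bound)
  also have "\<dots> \<le> (\<integral>x. 2 * \<delta> \<partial>P)"
    using int sq by (intro integral_mono) auto
  finally have L: "\<bar>?L1 - ?L2\<bar> \<le> 2 * \<delta>"
    by (simp add: prob_space)
  have K: "0 \<le> ?K" using c \<delta> by simp
  have "(sqrt (1 / ?L1 * (e1 x)\<^sup>2) - sqrt (1 / ?L2 * (e2 x)\<^sup>2))\<^sup>2 \<le> ?K\<^sup>2" for x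
  proof -
    have "\<bar>e1 x / sqrt ?L1 - e2 x / sqrt ?L2\<bar> \<le> ?K"
      using e2[of x] by (intro normalised_diff_le c diff L) auto
    then have "\<bar>e1 x / sqrt ?L1 - e2 x / sqrt ?L2\<bar>\<^sup>2 \<le> ?K\<^sup>2"
      by (intro power_mono) auto
    then show ?thesis
      using e1(1)[of x] e2(1)[of x] by (simp add: real_sqrt_divide)
  qed
  \<comment> \<open>A pointwise bound passes to the integral with the same constant because
    \<open>P\<close> has mass 1.\<close>
  then have "(\<integral>x. (sqrt (1 / ?L1 * (e1 x)\<^sup>2) - sqrt (1 / ?L2 * (e2 x)\<^sup>2))\<^sup>2 \<partial>P) \<le> ?K\<^sup>2"
    by (intro integral_le_const integrable_const_bound[where B="?K\<^sup>2"]) auto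
  then have "sqrt (\<integral>x. (sqrt (1 / ?L1 * (e1 x)\<^sup>2) - sqrt (1 / ?L2 * (e2 x)\<^sup>2))\<^sup>2 \<partial>P) \<le> ?K"
    using K by (intro real_le_lsqrt) auto
  moreover have "hellinger_dist \<nu> \<mu>1 \<mu>2 =
      sqrt (\<integral>x. (sqrt (1 / ?L1 * (e1 x)\<^sup>2) - sqrt (1 / ?L2 * (e2 x)\<^sup>2))\<^sup>2 \<partial>P)"
    using \<nu> c e1(1) e2(1) unfolding \<mu>1 \<mu>2
    by (intro hellinger_dist_density sigma_finite_measure_axioms) (auto simp: less_imp_neq[symmetric])
  ultimately show ?thesis by simp
qed

section \<open>Local Lipschitz dependence of the posterior on the data\<close>

theorem theorem4p2:
  fixes \<Gamma> :: "(real^2) set" and c :: "real^2" and R ka kb k \<sigma> :: real and M N :: nat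
    and \<mu>0 :: "(coeff_index \<Rightarrow> real) measure"
    and \<mu> :: "(real^2 \<Rightarrow> complex) \<Rightarrow> (coeff_index \<Rightarrow> real) measure"
  assumes "\<Gamma> \<subseteq> sphere 0 1" and "\<Gamma> \<in> sets arc_length"
    and "0 < ka" and "ka < kb" and "k \<in> {ka..kb}"
    and "0 < R" and "1 \<le> M" and "0 < \<sigma>"
    and "gaussian_measure (coeff_indices M N) \<mu>0"
    and "emeasure \<mu>0 (space (coeff_space M N)) = 1"
    and "\<And>U. U \<in> L2_space (arc_length_on \<Gamma>) \<Longrightarrow> absolutely_continuous \<mu>0 (\<mu> U)"
    and "\<And>U. U \<in> L2_space (arc_length_on \<Gamma>) \<Longrightarrow>
           \<mu> U = density \<mu>0 (\<lambda>A. ennreal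
             (1 / evidence \<Gamma> c R M N k \<sigma> \<mu>0 U * exp (- misfit \<Gamma> c R M N k \<sigma> A U)))"
  shows "\<forall>r>0. \<exists>Mr>0. \<forall>U1\<in>L2_space (arc_length_on \<Gamma>). \<forall>U2\<in>L2_space (arc_length_on \<Gamma>).
           max (L2_norm (arc_length_on \<Gamma>) U1) (L2_norm (arc_length_on \<Gamma>) U2) \<le> r \<longrightarrow>
           (\<forall>\<nu>. common_reference \<nu> (\<mu> U1) (\<mu> U2) \<longrightarrow>
             hellinger_dist \<nu> (\<mu> U1) (\<mu> U2)
               \<le> Mr * L2_norm (arc_length_on \<Gamma>) (\<lambda>xh. U1 xh - U2 xh))"
proof (intro allI impI)
  fix r :: real assume r: "0 < r"
  let ?\<Omega> = "arc_length_on \<Gamma>"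
  let ?F = "forward_op c R M N k" and ?\<Phi> = "\<lambda>U A. misfit \<Gamma> c R M N k \<sigma> A U"
  have sets: "sets \<mu>0 = sets (coeff_space M N)"
    using assms(9) by (simp add: gaussian_measure_def coeff_space_def)
  interpret prob_space \<mu>0
    using assms(10) sets_eq_imp_space_eq[OF sets] by (intro prob_spaceI) simp
  have F: "?F A \<in> L2_space ?\<Omega>" for A
    by (rule forward_op_L2_space[OF assms(6,2)])
  \<comment> \<open>Zero data serve as reference: the misfit there is the squared norm of
    \<open>?F A\<close> divided by \<open>2 * \<sigma>^2\<close>.\<close>
  have zero: "(\<lambda>_. 0) \<in> L2_space ?\<Omega>"
    by (simp add: L2_space_def)
  have \<Phi>_meas: "?\<Phi> U \<in> borel_measurable \<mu>0" if "U \<in> L2_space ?\<Omega>" for U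
    by (rule borel_measurable_misfit[OF assms(6,2) sets that])
  note [measurable] = \<Phi>_meas[OF zero]
  have \<Phi>_nonneg: "0 \<le> ?\<Phi> U A" for U A
    by (simp add: misfit_def)
  have \<Phi>_le: "?\<Phi> U A \<le> r\<^sup>2 / \<sigma>\<^sup>2 + 2 * ?\<Phi> (\<lambda>_. 0) A"
    if U: "U \<in> L2_space ?\<Omega>" "L2_norm ?\<Omega> U \<le> r" for U A
  proof -
    let ?u = "L2_norm ?\<Omega> U" and ?f = "L2_norm ?\<Omega> (\<lambda>xh. 0 - ?F A xh)"
    have "L2_norm ?\<Omega> (\<lambda>xh. U xh - ?F A xh) \<le> ?u + ?f"
      using U F zero by (intro L2_norm_triangle L2_space_diff) (auto intro: norm_triangle_ineq4)
    then have "(L2_norm ?\<Omega> (\<lambda>xh. U xh - ?F A xh))\<^sup>2 \<le> (?u + ?f)\<^sup>2"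
      by (intro power_mono L2_norm_nonneg)
    also have "\<dots> \<le> 2 * ?u\<^sup>2 + 2 * ?f\<^sup>2"
      using sum_squares_bound[of ?u ?f] by (simp add: power2_sum)
    also have "\<dots> \<le> 2 * r\<^sup>2 + 2 * ?f\<^sup>2"
      using U(2) by (intro add_mono mult_left_mono power_mono L2_norm_nonneg) auto
    finally have "?\<Phi> U A \<le> 1 / (2 * \<sigma>\<^sup>2) * (2 * r\<^sup>2 + 2 * ?f\<^sup>2)"
      unfolding misfit_def by (intro mult_left_mono) auto
    also have "\<dots> = r\<^sup>2 / \<sigma>\<^sup>2 + 2 * ?\<Phi> (\<lambda>_. 0) A"
      by (simp add: misfit_def add_divide_distrib)
    finally show ?thesis .
  qed
  \<comment> \<open>By \<open>\<Phi>_le\<close>, \<open>b\<close> lies below the likelihood of every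
    datum of norm at most \<open>r\<close>, so \<open>C\<close> is a lower bound for the evidence
    that depends on the data only through \<open>r\<close>.\<close>
  define b where "b = (\<lambda>A. exp (- (r\<^sup>2 / \<sigma>\<^sup>2 + 2 * ?\<Phi> (\<lambda>_. 0) A)))"
  define C where "C = (\<integral>A. b A \<partial>\<mu>0)"
  have b_int: "integrable \<mu>0 b"
  proof (intro integrable_const_bound[where B=1] AE_I2)
    have "0 \<le> r\<^sup>2 / \<sigma>\<^sup>2 + 2 * ?\<Phi> (\<lambda>_. 0) A" for A
      using \<Phi>_nonneg by simp
    then show "norm (b A) \<le> 1" for A
      by (simp only: b_def real_norm_def abs_exp_cancel exp_le_one_iff neg_le_0_iff_le)
  qed (simp add: b_def)
  \<comment> \<open>\<open>b\<close> is strictly positive everywhere, hence so is its mean under a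
    probability measure.\<close>
  then have C: "0 < C"
    unfolding C_def by (rule expectation_greater) (simp add: b_def)
  have C_le: "C \<le> evidence \<Gamma> c R M N k \<sigma> \<mu>0 U"
    if U: "U \<in> L2_space ?\<Omega>" "L2_norm ?\<Omega> U \<le> r" for U
    unfolding C_def evidence_def
  proof (rule integral_mono[OF b_int])
    show "integrable \<mu>0 (\<lambda>A. exp (- ?\<Phi> U A))"
      using \<Phi>_meas[OF U(1)] \<Phi>_nonneg by (intro integrable_const_bound[where B=1] AE_I2) auto
    show "b A \<le> exp (- ?\<Phi> U A)" for A
      unfolding b_def using \<Phi>_le[OF U, of A] by simp
  qed
  let ?K = "1 / sqrt C + 1 / (C * sqrt C)"
  \<comment> \<open>The square root of the likelihood, whence \<open>4 * \<sigma>^2\<close> in place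
    of \<open>2 * \<sigma>^2\<close>.\<close>
  define e where "e = (\<lambda>U A. exp (- (L2_norm ?\<Omega> (\<lambda>xh. U xh - ?F A xh))\<^sup>2 / (4 * \<sigma>\<^sup>2)))"
  have e_sq: "(e U A)\<^sup>2 = exp (- ?\<Phi> U A)" for U A
    by (simp add: e_def misfit_def power2_eq_square flip: exp_add)
  have e_eq: "e U = (\<lambda>A. exp (- ?\<Phi> U A / 2))" for U
    by (simp add: e_def misfit_def fun_eq_iff)
  have e_le: "e U A \<le> 1" for U A
    using \<Phi>_nonneg[of A U] by (simp add: e_eq)
  have e_meas: "e U \<in> borel_measurable \<mu>0" if "U \<in> L2_space ?\<Omega>" for U
    unfolding e_eq using \<Phi>_meas[OF that] by measurable
  have e_diff: "\<bar>e U1 A - e U2 A\<bar> \<le> 1 / \<sigma> * L2_norm ?\<Omega> (\<lambda>xh. U1 xh - U2 xh)"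
    if U: "U1 \<in> L2_space ?\<Omega>" "U2 \<in> L2_space ?\<Omega>" for U1 U2 A
  proof -
    let ?n = "\<lambda>U. L2_norm ?\<Omega> (\<lambda>xh. U xh - ?F A xh)"
    have "\<bar>e U1 A - e U2 A\<bar> \<le> 1 / \<sigma> * \<bar>?n U1 - ?n U2\<bar>"
      unfolding e_def by (intro gaussian_lipschitz assms(8) L2_norm_nonneg)
    \<comment> \<open>\<open>?F A\<close> cancels in the difference of the residuals, so the bound
      is uniform in \<open>A\<close>.\<close>
    also have "\<bar>?n U1 - ?n U2\<bar> \<le> L2_norm ?\<Omega> (\<lambda>xh. U1 xh - U2 xh)"
      using L2_norm_reverse_triangle[OF L2_space_diff[OF U(1) F] L2_space_diff[OF U(2) F], of A A]
      by simp
    finally show ?thesis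
      using assms(8) by (simp add: divide_right_mono)
  qed
  show "\<exists>Mr>0. \<forall>U1\<in>L2_space ?\<Omega>. \<forall>U2\<in>L2_space ?\<Omega>.
      max (L2_norm ?\<Omega> U1) (L2_norm ?\<Omega> U2) \<le> r \<longrightarrow>
      (\<forall>\<nu>. common_reference \<nu> (\<mu> U1) (\<mu> U2) \<longrightarrow>
        hellinger_dist \<nu> (\<mu> U1) (\<mu> U2) \<le> Mr * L2_norm ?\<Omega> (\<lambda>xh. U1 xh - U2 xh))"
  \<comment> \<open>\<open>1 / \<sigma>\<close> comes from the Lipschitz bound on \<open>e\<close>,
    and \<open>?K\<close> from normalising with evidences of at least \<open>C\<close>.\<close>
  proof (intro exI[of _ "?K / \<sigma>"] conjI ballI impI allI)
    show "0 < ?K / \<sigma>"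
      using C assms(8) by (simp add: add_pos_pos)
    fix U1 U2 \<nu>
    assume U: "U1 \<in> L2_space ?\<Omega>" "U2 \<in> L2_space ?\<Omega>" "max (L2_norm ?\<Omega> U1) (L2_norm ?\<Omega> U2) \<le> r"
      and \<nu>: "common_reference \<nu> (\<mu> U1) (\<mu> U2)"
    have "hellinger_dist \<nu> (\<mu> U1) (\<mu> U2) \<le> ?K * (1 / \<sigma> * L2_norm ?\<Omega> (\<lambda>xh. U1 xh - U2 xh))"
    proof (rule hellinger_dist_normalised_le[where P=\<mu>0 and ?e1.0="e U1" and ?e2.0="e U2"])
      show "prob_space \<mu>0" by (rule prob_space_axioms)
      show "C \<le> (\<integral>A. (e U1 A)\<^sup>2 \<partial>\<mu>0)" "C \<le> (\<integral>A. (e U2 A)\<^sup>2 \<partial>\<mu>0)"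
        using U C_le unfolding e_sq evidence_def by auto
      show "\<mu> U1 = density \<mu>0 (\<lambda>A. ennreal (1 / (\<integral>A. (e U1 A)\<^sup>2 \<partial>\<mu>0) * (e U1 A)\<^sup>2))"
        "\<mu> U2 = density \<mu>0 (\<lambda>A. ennreal (1 / (\<integral>A. (e U2 A)\<^sup>2 \<partial>\<mu>0) * (e U2 A)\<^sup>2))"
        unfolding e_sq using assms(12) U(1,2) unfolding evidence_def by auto
    qed (use U C \<nu> e_meas e_le e_diff in \<open>auto simp: e_def\<close>)
    then show "hellinger_dist \<nu> (\<mu> U1) (\<mu> U2) \<le> ?K / \<sigma> * L2_norm ?\<Omega> (\<lambda>xh. U1 xh - U2 xh)"
      by simp
  qed
qed

end
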